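(* Let $d\ge3$ be an integer and let $R_1^2(z)=\sum_j(z-\lambda_j^2)_+$ be the first Riesz-mean of the eigenvalues of the biharmonic operator $\Delta^2$ on $\mathbb{S}^d$. For all $z\ge0$, $$ R_1^2(z)\geq L^{class}_{1,d,2}|\mathbb{S}^d|z^{1+\frac d4}=\frac{8}{(d+4)\Gamma(d+1)}z^{1+\frac d4}. $$
   Context: $\mathbb{S}^d$ is the round unit sphere in $\mathbb{R}^{d+1}$. The $\lambda_j$ are the eigenvalues of $-\Delta$ on $\mathbb{S}^d$ counted with multiplicity: the distinct values are $\lambda_{(l)}=l(l+d-1)$, $l\in\mathbb{N}=\{0,1,2,\dots\}$, with multiplicity $m_{l,d}=\binom{d+l}{l}-\binom{d+l-2}{l-2}$ (a binomial coefficient with negative lower entry being $0$). The eigenvalues of $\Delta^2$ are the $\lambda_j^2$, with the same multiplicities; $a_+=\max(a,0)$. The semiclassical constant is $$L^{class}_{\gamma,d,p}=(4\pi)^{-d/2}\frac{\Gamma(\gamma+1)\Gamma(1+\frac{d}{2p})}{\Gamma(1+\frac d2)\Gamma(1+\gamma+\frac{d}{2p})}.$$ *)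

theory Defs
  imports "HOL-Analysis.Analysis"
begin

text \<open>
  The distinct eigenvalues of the (positive) Laplace--Beltrami operator on the round unit sphere
  of dimension \<open>d\<close>, and their multiplicities. The subtraction in the multiplicity never truncates
  (lemma \<open>sphere_mult_no_truncation\<close> below).
\<close>

definition sphere_eigenvalue :: "nat \<Rightarrow> nat \<Rightarrow> real" where
  "sphere_eigenvalue d l = real l * (real l + real d - 1)"

definition sphere_mult :: "nat \<Rightarrow> nat \<Rightarrow> nat" where
  "sphere_mult d l =
     ((d + l) choose l) - (if l < 2 then 0 else (d + l - 2) choose (l - 2))"

text \<open>
  \<open>lam 0, lam 1, \<dots>\<close> lists these eigenvalues, each repeated according to its multiplicity. No order is
  imposed on the list. Cardinalities are those of finite sets, since all multiplicities are positive.
\<close>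

definition sphere_eigenvalue_sequence :: "nat \<Rightarrow> (nat \<Rightarrow> real) \<Rightarrow> bool" where
  "sphere_eigenvalue_sequence d lam \<longleftrightarrow>
     range lam = range (sphere_eigenvalue d) \<and>
     (\<forall>l. card {j. lam j = sphere_eigenvalue d l} = sphere_mult d l)"

definition riesz_mean1 :: "(nat \<Rightarrow> real) \<Rightarrow> real \<Rightarrow> real" where
  "riesz_mean1 \<mu> z = (\<Sum>j. max (z - \<mu> j) 0)"

definition L_class :: "real \<Rightarrow> real \<Rightarrow> real \<Rightarrow> real" where
  "L_class \<gamma> d p =
     (4 * pi) powr (- d / 2) * (Gamma (\<gamma> + 1) * Gamma (1 + d / (2 * p)))
       / (Gamma (1 + d / 2) * Gamma (1 + \<gamma> + d / (2 * p)))"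

text \<open>
  Surface measure of a subset of the unit sphere, in the normalisation of polar coordinates: the
  dimension of the ambient space times the Lebesgue measure of the solid cone over the set.
\<close>

definition sphere_measure :: "'a::euclidean_space set \<Rightarrow> real" where
  "sphere_measure A =
     real DIM('a) * measure lebesgue {t *\<^sub>R x | t x. 0 \<le> t \<and> t \<le> 1 \<and> x \<in> A}"


text \<open>
  The remaining facts show that the notions above are meaningful: multiplicities do not truncate
  and are positive, eigenvalue sequences exist, and the sum in the Riesz mean has only finitely
  many nonzero terms.
\<close>

lemma binomial_shift2_less:
  assumes "2 \<le> l" "1 \<le> d"
  shows "(d + l - 2) choose (l - 2) < (d + l) choose l"
proof -
  obtain k where k: "l = Suc (Suc k)" using assms by (metis add_2_eq_Suc le_Suc_ex)
  obtain e where e: "d = Suc e" using assms by (metis One_nat_def Suc_le_D)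
  have "0 < (d + k) choose Suc k" by (rule zero_less_binomial) (use e in simp)
  then show ?thesis by (simp add: k)
qed

lemma sphere_mult_no_truncation:
  assumes "1 \<le> d"
  shows "real (sphere_mult d l) =
    real ((d + l) choose l) - (if l < 2 then 0 else real ((d + l - 2) choose (l - 2)))"
  using binomial_shift2_less[OF _ assms, of l]
  by (auto simp: sphere_mult_def of_nat_diff)

lemma sphere_mult_pos:
  assumes "1 \<le> d"
  shows "0 < sphere_mult d l"
  using binomial_shift2_less[OF _ assms, of l]
  by (auto simp: sphere_mult_def zero_less_binomial_iff)

lemma sphere_eigenvalue_strict_mono:
  assumes "1 \<le> d"
  shows "strict_mono (sphere_eigenvalue d)"
proof (rule strict_monoI)
  fix k l :: nat
  assume "k < l"
  then have "real k < real l" "real k + real d - 1 < real l + real d - 1"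
    "0 \<le> real k + real d - 1" using assms by auto
  then show "sphere_eigenvalue d k < sphere_eigenvalue d l"
    unfolding sphere_eigenvalue_def by (intro mult_strict_mono') auto
qed

lemma sphere_eigenvalue_sequence_exists:
  assumes "1 \<le> d"
  shows "\<exists>lam. sphere_eigenvalue_sequence d lam"
proof -
  let ?I = "SIGMA l:UNIV. {..<sphere_mult d l}"
  have "inj (\<lambda>l::nat. (l, 0::nat))" by (auto intro: injI)
  moreover have "range (\<lambda>l::nat. (l, 0::nat)) \<subseteq> ?I" using sphere_mult_pos[OF assms] by auto
  ultimately have inf: "infinite ?I" by (meson finite_subset range_inj_infinite)
  define f where "f = from_nat_into ?I"
  have f: "bij_betw f UNIV ?I"
    unfolding f_def by (rule bij_betw_from_nat_into) (use inf in auto)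
  have inj: "inj (sphere_eigenvalue d)"
    using sphere_eigenvalue_strict_mono[OF assms] by (rule strict_mono_imp_inj_on)
  define lam where "lam = (\<lambda>j. sphere_eigenvalue d (fst (f j)))"
  have "fst ` ?I = UNIV" using sphere_mult_pos[OF assms] by force
  then have "range (\<lambda>j. fst (f j)) = UNIV"
    using bij_betw_imp_surj_on[OF f] by (metis image_image)
  then have "range lam = range (sphere_eigenvalue d)"
    unfolding lam_def by (metis image_image)
  moreover have "card {j. lam j = sphere_eigenvalue d l} = sphere_mult d l" for l
  proof -
    have "{j. lam j = sphere_eigenvalue d l} = {j. fst (f j) = l}"
      using inj by (auto simp: lam_def inj_eq)
    moreover have "bij_betw f {j. fst (f j) = l} ({l} \<times> {..<sphere_mult d l})"
    proof (rule bij_betw_subset[OF f, of "{j. fst (f j) = l}"])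
      show "f ` {j. fst (f j) = l} = {l} \<times> {..<sphere_mult d l}"
      proof (intro equalityI subsetI)
        fix p assume "p \<in> f ` {j. fst (f j) = l}"
        then have "fst p = l" "p \<in> ?I" using bij_betw_apply[OF f] by auto
        then show "p \<in> {l} \<times> {..<sphere_mult d l}" by (cases p) auto
      next
        fix p assume p: "p \<in> {l} \<times> {..<sphere_mult d l}"
        then have "p \<in> range f" using bij_betw_imp_surj_on[OF f] by auto
        then obtain j where "p = f j" by blast
        moreover have "fst p = l" using p by auto
        ultimately show "p \<in> f ` {j. fst (f j) = l}" by simp
      qed
    qed simp
    ultimately show ?thesis by (metis bij_betw_same_card card_cartesian_product_singleton card_lessThan)
  qed
  ultimately show ?thesis unfolding sphere_eigenvalue_sequence_def by blast
qed

lemma finite_eigenvalues_below: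
  assumes "1 \<le> d" "sphere_eigenvalue_sequence d lam"
  shows "finite {j. (lam j)\<^sup>2 < z}"
proof -
  have fin: "finite {j. lam j = sphere_eigenvalue d l}" for l
    using assms(2) sphere_mult_pos[OF assms(1), of l]
    unfolding sphere_eigenvalue_sequence_def by (metis card.infinite less_irrefl)
  obtain N :: nat where N: "z \<le> real N" using real_arch_simple by blast
  have "\<exists>l<N + 2. lam j = sphere_eigenvalue d l" if "(lam j)\<^sup>2 < z" for j
  proof -
    have "lam j \<in> range (sphere_eigenvalue d)"
      using assms(2) unfolding sphere_eigenvalue_sequence_def by blast
    then obtain l where l: "lam j = sphere_eigenvalue d l" by blast
    have "l < N + 2"
    proof (rule ccontr)
      assume "\<not> l < N + 2"
      then have ln: "real N + 2 \<le> real l" by linarith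
      have "real l * 1 \<le> sphere_eigenvalue d l"
        unfolding sphere_eigenvalue_def by (rule mult_left_mono) (use ln assms(1) in auto)
      then have "real l * 1 \<le> lam j * lam j" using ln l by (intro mult_mono) auto
      then show False using that N ln by (simp add: power2_eq_square)
    qed
    then show ?thesis using l by blast
  qed
  then have "{j. (lam j)\<^sup>2 < z} \<subseteq> (\<Union>l<N + 2. {j. lam j = sphere_eigenvalue d l})" by auto
  then show ?thesis using fin by (meson finite_UN finite_lessThan finite_subset)
qed

lemma riesz_mean1_summable:
  assumes "1 \<le> d" "sphere_eigenvalue_sequence d lam"
  shows "summable (\<lambda>j. max (z - (lam j)\<^sup>2) 0)"
  by (rule summable_finite[OF finite_eigenvalues_below[OF assms, of z]]) auto

end

theory Submission
  imports Defs
begin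

text \<open>
  As a function of \<open>z\<close> the Riesz mean is piecewise affine, with kinks at the squares of the
  distinct eigenvalues, whereas \<open>z\<close> raised to the power \<open>1 + d / 4\<close> is convex. If the inequality
  holds at two neighbouring kinks, then on the interval between them the power lies below its chord
  and the chord lies below the Riesz mean. Hence only \<open>z = t\<^sup>2\<close> with an eigenvalue
  \<open>t = L (L + d - 1)\<close> has to be considered (lemma \<open>riesz_mean1_ge_weyl\<close>).

  There the Riesz mean has a closed form (lemma \<open>node_riesz_closed_form\<close>): up to the factor
  \<open>(d + 2) (d + 4) d!\<close> it equals
  \<open>(4 t + d (d - 2)) (2 (d + 2) t - d\<^sup>2) L (L + 1) \<dots> (L + d - 1)\<close>.
  The semiclassical expression, multiplied by the same factor, is \<open>8 (d + 2) t\<^sup>2\<close> times \<open>t\<close> to the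
  power \<open>d / 2\<close>, and \<open>t\<close> is the product of the first and the last factor of the rising
  factorial. Pairing the factors from both ends, each pair has a product of at least \<open>t\<close>, so the
  rising factorial is at least \<open>t\<close> to the power \<open>d / 2\<close>. For \<open>d \<ge> 4\<close> the two remaining factors
  contribute at least \<open>8 (d + 2) t\<^sup>2\<close> because \<open>t \<ge> d\<close> (the latter being the smallest positive
  eigenvalue). For \<open>d = 3\<close> they fall short of this, but the rising factorial
  \<open>L (L + 1) (L + 2)\<close> is then larger than \<open>t\<close> to the power \<open>3 / 2\<close> by the factor
  \<open>sqrt (1 + 1 / t)\<close>, and this is enough (lemma \<open>weyl_le_closed_form\<close>).

  The value of the constant follows from the volume of the unit ball and Legendre's duplication
  formula (lemma \<open>L_class_mult_sphere_measure\<close>).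
\<close>

section \<open>Multiplicities and the counting function\<close>

lemma fact_mult_choose:
  "fact d * real ((d + l) choose l) = pochhammer (real l + 1) d"
proof -
  have "(d + l) choose l = (d + l) choose d"
    by (simp add: binomial_symmetric[of l "d + l"])
  then show ?thesis
    by (simp add: binomial_gbinomial gbinomial_pochhammer')
qed

text \<open>
  In terms of rising factorials the case distinction in the multiplicity disappears: for
  \<open>l < 2\<close> the rising factorial of \<open>l - 1\<close> contains the factor \<open>0\<close>, provided that \<open>d \<ge> 2\<close>.
  Since the two arguments differ by \<open>2\<close>, the sum over \<open>l\<close> telescopes to two terms.
\<close>
lemma fact_mult_sphere_mult:
  assumes "d \<ge> 2"
  shows "fact d * real (sphere_mult d l) = pochhammer (real l + 1) d - pochhammer (real l - 1) d"
proof (cases "l < 2")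
  case True
  obtain e where e: "d = Suc (Suc e)" using assms by (metis add_2_eq_Suc le_Suc_ex)
  have "pochhammer (real l - 1) d = 0"
    using True by (auto simp: e pochhammer_rec less_2_cases_iff)
  then show ?thesis
    using True assms by (simp add: sphere_mult_no_truncation fact_mult_choose)
next
  case False
  then obtain k where k: "l = k + 2" by (metis add.commute le_Suc_ex not_less)
  show ?thesis
    using assms fact_mult_choose[of d l] fact_mult_choose[of d k]
    by (simp add: sphere_mult_no_truncation k algebra_simps)
qed

lemma fact_mult_counting:
  assumes "d \<ge> 2"
  shows "fact d * (\<Sum>l\<le>L. real (sphere_mult d l)) = pochhammer (real L) d + pochhammer (real L + 1) d"
proof (induction L)
  case 0
  obtain e where e: "d = Suc (Suc e)" using assms by (metis add_2_eq_Suc le_Suc_ex)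
  show ?case using fact_mult_sphere_mult[OF assms, of 0] by (simp add: e pochhammer_rec)
next
  case (Suc L)
  then show ?case
    using fact_mult_sphere_mult[OF assms, of "Suc L"] by (simp add: algebra_simps)
qed

section \<open>The Riesz mean at the eigenvalues\<close>

text \<open>
  The Riesz mean at \<open>z = (sphere_eigenvalue d L)\<^sup>2\<close>, where the eigenvalues from the \<open>L\<close>-th on
  contribute nothing.
\<close>
definition node_riesz :: "nat \<Rightarrow> nat \<Rightarrow> real" where
  "node_riesz d L =
     (\<Sum>l<L. real (sphere_mult d l) * ((sphere_eigenvalue d L)\<^sup>2 - (sphere_eigenvalue d l)\<^sup>2))"

text \<open>
  The affine function that agrees with the Riesz mean between the \<open>L\<close>-th and the next eigenvalue,
  written with its value at the left end and its slope, the counting function.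
\<close>
lemma partial_riesz_eq_node_riesz:
  "(\<Sum>l\<le>L. real (sphere_mult d l) * (z - (sphere_eigenvalue d l)\<^sup>2)) =
     node_riesz d L + (\<Sum>l\<le>L. real (sphere_mult d l)) * (z - (sphere_eigenvalue d L)\<^sup>2)"
proof -
  let ?m = "\<lambda>l. real (sphere_mult d l)" and ?e = "sphere_eigenvalue d"
  have "node_riesz d L = (\<Sum>l\<le>L. ?m l * ((?e L)\<^sup>2 - (?e l)\<^sup>2))"
    by (simp add: node_riesz_def flip: lessThan_Suc_atMost)
  moreover have "(\<Sum>l\<le>L. ?m l * (z - (?e l)\<^sup>2)) =
      (\<Sum>l\<le>L. ?m l * ((?e L)\<^sup>2 - (?e l)\<^sup>2) + ?m l * (z - (?e L)\<^sup>2))"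
    by (rule sum.cong) (simp_all add: algebra_simps)
  ultimately show ?thesis
    by (simp add: sum.distrib sum_distrib_right)
qed

lemma node_riesz_Suc:
  "node_riesz d (Suc L) = node_riesz d L +
     (\<Sum>l\<le>L. real (sphere_mult d l)) *
       ((sphere_eigenvalue d (Suc L))\<^sup>2 - (sphere_eigenvalue d L)\<^sup>2)"
  unfolding partial_riesz_eq_node_riesz[symmetric]
  by (simp add: node_riesz_def lessThan_Suc_atMost)

text \<open>
  The rising factorials of \<open>L\<close> and \<open>L + 1\<close> share the factor \<open>q = (L + 1) \<dots> (L + d - 1)\<close>. It
  therefore divides both the counting function and the claimed value on either side of an induction
  step, and what remains is a polynomial identity in \<open>L\<close> and \<open>d\<close>.
\<close>
lemma node_riesz_closed_form:
  assumes "d \<ge> 2"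
  defines "ev \<equiv> sphere_eigenvalue d"
  shows "(real d + 2) * (real d + 4) * fact d * node_riesz d L =
    (4 * ev L + real d * (real d - 2)) * (2 * (real d + 2) * ev L - (real d)\<^sup>2) *
      pochhammer (real L) d"
proof (induction L)
  case 0
  then show ?case using assms by (simp add: node_riesz_def pochhammer_0_left)
next
  case (Suc L)
  obtain e where e: "d = Suc e" using assms by (metis Suc_le_D numeral_2_eq_2)
  define q where "q = pochhammer (real L + 1) e"
  have P0: "pochhammer (real L) d = real L * q"
    by (simp add: e q_def pochhammer_rec)
  have P1: "pochhammer (real L + 1) d = (real L + real d) * q"
    by (simp add: e q_def pochhammer_rec')
  have "(real d + 2) * (real d + 4) * fact d * node_riesz d (Suc L) =
     (real d + 2) * (real d + 4) * fact d * node_riesz d L +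
     (real d + 2) * (real d + 4) * (fact d * (\<Sum>l\<le>L. real (sphere_mult d l))) *
       ((ev (Suc L))\<^sup>2 - (ev L)\<^sup>2)"
    by (simp add: node_riesz_Suc ev_def algebra_simps)
  also have "\<dots> = (4 * ev L + real d * (real d - 2)) * (2 * (real d + 2) * ev L - (real d)\<^sup>2) *
      (real L * q) +
     (real d + 2) * (real d + 4) * (real L * q + (real L + real d) * q) *
       ((ev (Suc L))\<^sup>2 - (ev L)\<^sup>2)"
    unfolding Suc.IH fact_mult_counting[OF assms(1)] P0 P1 by simp
  also have "\<dots> = (4 * ev (Suc L) + real d * (real d - 2)) *
      (2 * (real d + 2) * ev (Suc L) - (real d)\<^sup>2) * ((real L + real d) * q)"
    unfolding ev_def sphere_eigenvalue_def of_nat_Suc by algebra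
  also have "(real L + real d) * q = pochhammer (real (Suc L)) d"
    using P1 by (simp add: add.commute)
  finally show ?case .
qed

section \<open>The bound at the eigenvalues\<close>

text \<open>
  In the square of the rising factorial the \<open>i\<close>-th factor is paired with the \<open>i\<close>-th factor from
  the end. All these pairs have the same sum, so the outermost pair has the smallest product.
\<close>
lemma pochhammer_sq_ge:
  assumes "x \<ge> 0" "d \<ge> 1"
  shows "(x * (x + real d - 1)) ^ d \<le> (pochhammer x d)\<^sup>2"
proof -
  have "pochhammer x d = (\<Prod>i<d. x + real i)"
    by (simp add: pochhammer_prod lessThan_atLeast0)
  moreover have "(\<Prod>i<d. x + real i) = (\<Prod>i<d. x + real (d - Suc i))"
    by (rule prod.nat_diff_reindex[symmetric])
  ultimately have eq: "(pochhammer x d)\<^sup>2 = (\<Prod>i<d. (x + real i) * (x + real (d - Suc i)))"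
    by (simp add: power2_eq_square prod.distrib)
  have "(x * (x + real d - 1)) ^ d = (\<Prod>i<d. x * (x + real d - 1))" by simp
  also have "\<dots> \<le> (\<Prod>i<d. (x + real i) * (x + real (d - Suc i)))"
  proof (rule prod_mono)
    fix i assume "i \<in> {..<d}"
    then have i: "real (d - Suc i) = real d - 1 - real i" "real d - 1 - real i \<ge> 0" by auto
    have "(x + real i) * (x + real (d - Suc i)) =
        x * (x + real d - 1) + real i * (real d - 1 - real i)"
      unfolding i(1) by (simp add: algebra_simps)
    moreover have "0 \<le> real i * (real d - 1 - real i)" using i(2) by simp
    moreover have "0 \<le> x * (x + real d - 1)" using assms by simp
    ultimately show "0 \<le> x * (x + real d - 1) \<and>
        x * (x + real d - 1) \<le> (x + real i) * (x + real (d - Suc i))"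
      by linarith
  qed
  finally show ?thesis by (simp add: eq)
qed

lemma sphere_eigenvalue_ge:
  assumes "d \<ge> 1" "L \<ge> 1"
  shows "real d \<le> sphere_eigenvalue d L"
  using strict_mono_mono[OF sphere_eigenvalue_strict_mono[OF assms(1)], THEN monoD, OF assms(2)]
  by (simp add: sphere_eigenvalue_def)

text \<open>
  The squared inequality at the eigenvalues of the three-dimensional sphere, divided by \<open>t\<^sup>2\<close>.
  The smallest positive eigenvalue is \<open>3\<close>, and in powers of \<open>t - 3\<close> the difference of the two
  sides has nonnegative coefficients.
\<close>
lemma dim3_polynomial_bound:
  fixes t :: real
  assumes "t \<ge> 3"
  shows "64 * t ^ 5 \<le> ((4 * t + 3) * (2 * t - 9/5))\<^sup>2 * (t + 1)"
proof -
  obtain s where s: "t = s + 3" "s \<ge> 0" using assms by (metis diff_add_cancel diff_ge_0_iff_ge)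
  have "((4 * t + 3) * (2 * t - 9/5))\<^sup>2 * (t + 1) - 64 * t ^ 5 =
      (1120 * s ^ 4 + 10836 * s ^ 3 + 35244 * s\<^sup>2 + 40905 * s) / 25 + 324"
    unfolding s(1) by (simp add: power2_eq_square eval_nat_numeral field_simps)
  moreover have "\<dots> \<ge> 0" using s(2) by simp
  ultimately show ?thesis by linarith
qed

text \<open>
  The dimension \<open>3\<close> is separate because \<open>pochhammer_sq_ge\<close> loses too much there: it replaces
  \<open>t\<^sup>2 (t + 1)\<close>, the exact square of \<open>L (L + 1) (L + 2)\<close>, by \<open>t\<^sup>3\<close>. For \<open>d = 4\<close> the bound on the
  other two factors still holds, with equality at \<open>t = 4\<close>.
\<close>
lemma weyl_le_closed_form:
  assumes "d \<ge> 3" "L \<ge> 1"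
  defines "t \<equiv> sphere_eigenvalue d L"
  shows "8 * (real d + 2) * t\<^sup>2 * t powr (real d / 2) \<le>
    (4 * t + real d * (real d - 2)) * (2 * (real d + 2) * t - (real d)\<^sup>2) * pochhammer (real L) d"
proof -
  define P where "P = pochhammer (real L) d"
  have td: "real d \<le> t" unfolding t_def using assms by (intro sphere_eigenvalue_ge) auto
  then have t0: "t > 0" using assms(1) by simp
  have pos: "P > 0" unfolding P_def using assms(2) by (intro pochhammer_pos) auto
  have powr_sq: "(t powr (real d / 2))\<^sup>2 = t ^ d"
    using t0 by (simp add: powr_powr flip: powr_numeral powr_realpow)
  show ?thesis
  proof (cases "d = 3")
    case True
    have eqs: "t = real L * (real L + 2)" "P = real L * (real L + 1) * (real L + 2)"
      by (simp_all add: True t_def sphere_eigenvalue_def P_def eval_nat_numeral pochhammer_Suc)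
    have P: "P\<^sup>2 = t\<^sup>2 * (t + 1)" unfolding eqs by algebra
    have "(8 * t\<^sup>2 * t powr (real d / 2))\<^sup>2 = 64 * t ^ 5 * t\<^sup>2"
      unfolding power_mult_distrib powr_sq by (simp add: True eval_nat_numeral)
    also have "\<dots> \<le> ((4 * t + 3) * (2 * t - 9/5))\<^sup>2 * (t + 1) * t\<^sup>2"
      using dim3_polynomial_bound[of t] td True by (intro mult_right_mono) auto
    also have "\<dots> = ((4 * t + 3) * (2 * t - 9/5) * P)\<^sup>2"
      by (simp add: power_mult_distrib P)
    finally have "8 * t\<^sup>2 * t powr (real d / 2) \<le> (4 * t + 3) * (2 * t - 9/5) * P"
      by (rule power2_le_imp_le) (use td pos True in auto)
    moreover have "8 * (real d + 2) * t\<^sup>2 * t powr (real d / 2) =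
        5 * (8 * t\<^sup>2 * t powr (real d / 2))"
      by (simp add: True)
    moreover have "(4 * t + real d * (real d - 2)) * (2 * (real d + 2) * t - (real d)\<^sup>2) * P =
        5 * ((4 * t + 3) * (2 * t - 9/5) * P)"
      by (simp add: True algebra_simps)
    ultimately show ?thesis unfolding P_def[symmetric] by linarith
  next
    case False
    with assms(1) have d4: "real d \<ge> 4" by simp
    have rising: "t powr (real d / 2) \<le> P"
    proof (rule power2_le_imp_le)
      show "(t powr (real d / 2))\<^sup>2 \<le> P\<^sup>2"
        unfolding powr_sq unfolding t_def sphere_eigenvalue_def P_def
        using assms(1) by (intro pochhammer_sq_ge) auto
    qed (use pos in simp)
    have factors: "8 * (real d + 2) * t\<^sup>2 \<le>
        (4 * t + real d * (real d - 2)) * (2 * (real d + 2) * t - (real d)\<^sup>2)"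
    proof -
      define D where "D = real d"
      \<comment> \<open>The difference of the two sides is affine in \<open>t\<close> and increasing, hence smallest at \<open>t = d\<close>,
        where it is a nonnegative multiple of \<open>d - 4\<close>.\<close>
      have "D ^ 3 * (D - 2) \<le> 2 * D * (D\<^sup>2 - 2 * D - 4) * D"
      proof -
        have "2 * D * (D\<^sup>2 - 2 * D - 4) * D - D ^ 3 * (D - 2) = D\<^sup>2 * ((D - 4) * (D + 2))"
          by algebra
        moreover have "\<dots> \<ge> 0" using d4 by (simp add: D_def)
        ultimately show ?thesis by linarith
      qed
      also have "\<dots> \<le> 2 * D * (D\<^sup>2 - 2 * D - 4) * t"
      proof (rule mult_left_mono)
        have "D\<^sup>2 - 2 * D - 4 = (D - 4) * (D + 2) + 4" by algebra
        then show "0 \<le> 2 * D * (D\<^sup>2 - 2 * D - 4)" using d4 by (simp add: D_def)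
      qed (use td D_def in simp)
      finally have "8 * (D + 2) * t\<^sup>2 \<le>
          8 * (D + 2) * t\<^sup>2 + (2 * D * (D\<^sup>2 - 2 * D - 4) * t - D ^ 3 * (D - 2))" by simp
      also have "\<dots> = (4 * t + D * (D - 2)) * (2 * (D + 2) * t - D\<^sup>2)" by algebra
      finally show ?thesis by (simp add: D_def)
    qed
    have "0 \<le> 8 * (real d + 2) * t\<^sup>2" by simp
    from mult_mono[OF factors rising order_trans[OF this factors]] show ?thesis
      by (simp add: P_def)
  qed
qed

text \<open>The product of the semiclassical constant and the surface measure of the sphere.\<close>
definition weyl_const :: "nat \<Rightarrow> real" where
  "weyl_const d = 8 / ((real d + 4) * fact d)"

lemma weyl_le_node_riesz:
  assumes "d \<ge> 3"
  shows "weyl_const d * ((sphere_eigenvalue d L)\<^sup>2) powr (1 + real d / 4) \<le> node_riesz d L"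
proof (cases "L = 0")
  case True
  then show ?thesis by (simp add: sphere_eigenvalue_def node_riesz_def)
next
  case False
  define t where "t = sphere_eigenvalue d L"
  have "t > 0" using sphere_eigenvalue_ge[of d L] False assms by (simp add: t_def)
  then have "(t\<^sup>2) powr (1 + real d / 4) = t\<^sup>2 * t powr (real d / 2)"
    using powr_powr[of t 2 "real d / 4"] by (simp add: powr_add)
  moreover have "(real d + 2) * (8 * t\<^sup>2 * t powr (real d / 2)) \<le>
      (real d + 2) * ((real d + 4) * fact d * node_riesz d L)"
  proof -
    have "(real d + 2) * (8 * t\<^sup>2 * t powr (real d / 2)) =
        8 * (real d + 2) * t\<^sup>2 * t powr (real d / 2)" by simp
    also have "\<dots> \<le> (4 * t + real d * (real d - 2)) * (2 * (real d + 2) * t - (real d)\<^sup>2) *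
        pochhammer (real L) d"
      unfolding t_def using assms False by (intro weyl_le_closed_form) auto
    also have "\<dots> = (real d + 2) * (real d + 4) * fact d * node_riesz d L"
      unfolding t_def using assms by (intro node_riesz_closed_form[symmetric]) simp
    finally show ?thesis by (simp only: mult.assoc)
  qed
  then have "8 * t\<^sup>2 * t powr (real d / 2) \<le> (real d + 4) * fact d * node_riesz d L"
    by (rule mult_left_le_imp_le) simp
  ultimately show ?thesis
    by (simp add: weyl_const_def t_def[symmetric] pos_divide_le_eq mult_ac)
qed

section \<open>Interpolation between the eigenvalues\<close>

text \<open>
  The origin is included because the first interval between eigenvalues starts at \<open>0\<close>.
\<close>
lemma convex_on_powr_nonneg:
  assumes "p \<ge> 1"
  shows "convex_on {0..} (\<lambda>x::real. x powr p)"
proof (rule convex_on_linorderI)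
  fix t x y :: real
  assume t: "0 < t" "t < 1" and xy: "x \<in> {0..}" "y \<in> {0..}" "x < y"
  show "((1 - t) *\<^sub>R x + t *\<^sub>R y) powr p \<le> (1 - t) * x powr p + t * y powr p"
  proof (cases "x = 0")
    case True
    have "t powr p \<le> t powr 1" using t assms by (intro powr_mono') auto
    then show ?thesis using True t xy by (simp add: powr_mult mult_right_mono)
  next
    case False
    then show ?thesis
      using convex_onD[OF powr_convex[OF assms], of t x y] t xy by simp
  qed
qed simp

text \<open>
  Taking positive parts and adding the remaining, nonnegative, terms can only increase the sum. The
  right-hand side is thus bounded below by one affine function for each \<open>L\<close>.
\<close>
lemma riesz_mean1_ge_partial:
  assumes "d \<ge> 1" "sphere_eigenvalue_sequence d lam"
  shows "(\<Sum>l\<le>L. real (sphere_mult d l) * (z - (sphere_eigenvalue d l)\<^sup>2))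
    \<le> riesz_mean1 (\<lambda>j. (lam j)\<^sup>2) z"
proof -
  define J where "J l = {j. lam j = sphere_eigenvalue d l}" for l
  have card: "card (J l) = sphere_mult d l" for l
    using assms(2) by (simp add: sphere_eigenvalue_sequence_def J_def)
  have fin: "finite (J l)" for l
    using card[of l] sphere_mult_pos[OF assms(1), of l] by (metis card.infinite less_irrefl)
  have inj: "inj (sphere_eigenvalue d)"
    using sphere_eigenvalue_strict_mono[OF assms(1)] by (rule strict_mono_imp_inj_on)
  have "(\<Sum>l\<le>L. real (sphere_mult d l) * (z - (sphere_eigenvalue d l)\<^sup>2)) =
      (\<Sum>l\<le>L. \<Sum>j\<in>J l. z - (lam j)\<^sup>2)"
  proof (rule sum.cong)
    fix l
    have "(\<Sum>j\<in>J l. z - (lam j)\<^sup>2) = (\<Sum>j\<in>J l. z - (sphere_eigenvalue d l)\<^sup>2)"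
      by (rule sum.cong) (auto simp: J_def)
    then show "real (sphere_mult d l) * (z - (sphere_eigenvalue d l)\<^sup>2) = (\<Sum>j\<in>J l. z - (lam j)\<^sup>2)"
      by (simp add: card)
  qed simp
  also have "\<dots> = (\<Sum>j\<in>(\<Union>l\<le>L. J l). z - (lam j)\<^sup>2)"
    by (rule sum.UNION_disjoint[symmetric]) (use fin inj in \<open>auto simp: J_def inj_eq\<close>)
  also have "\<dots> \<le> (\<Sum>j\<in>(\<Union>l\<le>L. J l). max (z - (lam j)\<^sup>2) 0)"
    by (rule sum_mono) simp
  also have "\<dots> \<le> riesz_mean1 (\<lambda>j. (lam j)\<^sup>2) z"
    unfolding riesz_mean1_def
    by (rule sum_le_suminf[OF riesz_mean1_summable[OF assms]]) (use fin in auto)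
  finally show ?thesis .
qed

lemma bracketing_eigenvalues:
  assumes "d \<ge> 1" "z \<ge> 0"
  obtains L where "(sphere_eigenvalue d L)\<^sup>2 \<le> z" "z < (sphere_eigenvalue d (Suc L))\<^sup>2"
proof -
  obtain n :: nat where n: "z < real n" using reals_Archimedean2 by blast
  then have n1: "1 \<le> real n" using assms(2) by (cases n) auto
  have "real n * 1 \<le> sphere_eigenvalue d n"
    unfolding sphere_eigenvalue_def using n1 assms(1) by (intro mult_left_mono) auto
  then have "real n * 1 \<le> (sphere_eigenvalue d n)\<^sup>2"
    unfolding power2_eq_square using n1 by (intro mult_mono) auto
  with n have ex: "z < (sphere_eigenvalue d n)\<^sup>2" by simp
  define m where "m = (LEAST m. z < (sphere_eigenvalue d m)\<^sup>2)"
  have m: "z < (sphere_eigenvalue d m)\<^sup>2" unfolding m_def using ex by (rule LeastI)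
  then obtain L where L: "m = Suc L" using assms(2) by (cases m) (auto simp: sphere_eigenvalue_def)
  then have "\<not> z < (sphere_eigenvalue d L)\<^sup>2" using not_less_Least[of L] by (metis lessI m_def)
  then show ?thesis using that[of L] m L by simp
qed

text \<open>
  The affine function belonging to the interval \<open>[a, b]\<close> of neighbouring squared eigenvalues has
  the values of the Riesz mean at both ends. It dominates \<open>f\<close> there, hence on the whole
  interval by convexity of \<open>f\<close>.
\<close>
lemma riesz_mean1_ge_weyl:
  assumes "d \<ge> 3" "sphere_eigenvalue_sequence d lam" "z \<ge> 0"
  shows "weyl_const d * z powr (1 + real d / 4) \<le> riesz_mean1 (\<lambda>j. (lam j)\<^sup>2) z"
proof -
  have d1: "d \<ge> 1" using assms(1) by simp
  obtain L where L: "(sphere_eigenvalue d L)\<^sup>2 \<le> z" "z < (sphere_eigenvalue d (Suc L))\<^sup>2"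
    using bracketing_eigenvalues[OF d1 assms(3)] .
  define a b where "a = (sphere_eigenvalue d L)\<^sup>2" and "b = (sphere_eigenvalue d (Suc L))\<^sup>2"
  define f where "f = (\<lambda>x. weyl_const d * x powr (1 + real d / 4))"
  define N where "N = (\<Sum>l\<le>L. real (sphere_mult d l))"
  have ab: "a \<le> z" "z < b" "a \<ge> 0" using L by (simp_all add: a_def b_def)
  have "convex_on {a..b} f"
    unfolding f_def
    by (intro convex_on_cmul convex_on_subset[OF convex_on_powr_nonneg])
       (use ab in \<open>auto simp: weyl_const_def\<close>)
  define s where "s = (z - a) / (b - a)"
  have s: "0 \<le> s" "s \<le> 1" using ab by (auto simp: s_def)
  have z: "z = (1 - s) * a + s * b"
  proof -
    have "s * (b - a) = z - a" using ab by (simp add: s_def)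
    then show ?thesis by (simp add: algebra_simps)
  qed
  have node: "f a \<le> node_riesz d L" "f b \<le> node_riesz d L + N * (b - a)"
    using weyl_le_node_riesz[OF assms(1), of L] weyl_le_node_riesz[OF assms(1), of "Suc L"]
    by (simp_all add: f_def a_def b_def N_def node_riesz_Suc)
  have "f z \<le> (1 - s) * f a + s * f b"
    using convex_onD_Icc[OF \<open>convex_on {a..b} f\<close>, of s] s ab z by simp
  also have "\<dots> \<le> (1 - s) * node_riesz d L + s * (node_riesz d L + N * (b - a))"
    using node s by (intro add_mono mult_left_mono) auto
  also have "\<dots> = node_riesz d L + N * (z - a)"
    by (subst z) (simp add: algebra_simps)
  also have "\<dots> = (\<Sum>l\<le>L. real (sphere_mult d l) * (z - (sphere_eigenvalue d l)\<^sup>2))"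
    by (simp add: partial_riesz_eq_node_riesz N_def a_def)
  also have "\<dots> \<le> riesz_mean1 (\<lambda>j. (lam j)\<^sup>2) z"
    by (rule riesz_mean1_ge_partial[OF d1 assms(2)])
  finally show ?thesis by (simp add: f_def)
qed

section \<open>The semiclassical constant\<close>

lemma Gamma_real_duplication:
  fixes x :: real
  assumes "x > 0"
  shows "Gamma x * Gamma (x + 1/2) = 2 powr (1 - 2 * x) * sqrt pi * Gamma (2 * x)"
proof -
  have pos: "complex_of_real y \<notin> \<int>\<^sub>\<le>\<^sub>0" if "y > 0" for y
    using that by (auto elim!: nonpos_Ints_cases simp: complex_eq_iff)
  have "complex_of_real (Gamma x * Gamma (x + 1/2)) =
      Gamma (complex_of_real x) * Gamma (complex_of_real x + 1/2)"
    using Gamma_complex_of_real[of x] Gamma_complex_of_real[of "x + 1/2"] by simp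
  also have "\<dots> = exp ((1 - 2 * complex_of_real x) * of_real (ln 2)) * of_real (sqrt pi) *
      Gamma (2 * complex_of_real x)"
    using pos[of x] pos[of "x + 1/2"] assms by (intro Gamma_legendre_duplication) auto
  also have "\<dots> = complex_of_real (exp ((1 - 2 * x) * ln 2) * sqrt pi * Gamma (2 * x))"
    using Gamma_complex_of_real[of "2 * x"] by (simp add: exp_of_real[symmetric])
  finally have "Gamma x * Gamma (x + 1/2) = exp ((1 - 2 * x) * ln 2) * sqrt pi * Gamma (2 * x)"
    by (simp only: of_real_eq_iff)
  then show ?thesis by (simp add: powr_def)
qed

lemma cone_over_unit_sphere:
  "{t *\<^sub>R x | t x. 0 \<le> t \<and> t \<le> 1 \<and> x \<in> sphere (0::'a::euclidean_space) 1} = cball 0 1"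
proof (intro equalityI subsetI)
  fix y :: 'a assume y: "y \<in> cball 0 1"
  obtain u :: 'a where u: "u \<in> Basis" using nonempty_Basis by blast
  show "y \<in> {t *\<^sub>R x | t x. 0 \<le> t \<and> t \<le> 1 \<and> x \<in> sphere 0 1}"
  proof (cases "y = 0")
    case True
    then have "y = 0 *\<^sub>R u" "u \<in> sphere 0 1" using u by auto
    then show ?thesis by force
  next
    case False
    then have "y = norm y *\<^sub>R (y /\<^sub>R norm y)" "y /\<^sub>R norm y \<in> sphere 0 1" by auto
    then show ?thesis using y by (smt (verit) mem_Collect_eq mem_cball_0 norm_ge_zero)
  qed
qed auto

lemma sphere_measure_unit_sphere:
  "sphere_measure (sphere (0::'a::euclidean_space) 1) = real DIM('a) * unit_ball_vol (real DIM('a))"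
  unfolding sphere_measure_def cone_over_unit_sphere using content_cball[of 1 "0::'a"] by simp

text \<open>
  The denominator contains the Gamma function at \<open>1 + d / 2\<close> (from \<open>L_class\<close>) and at
  \<open>(d + 1) / 2 + 1\<close> (from the volume of the ball in dimension \<open>d + 1\<close>). Shifting the latter down
  by \<open>1\<close> leaves two arguments that differ by \<open>1 / 2\<close>, and the duplication formula combines them
  into the factorial of \<open>d\<close>.
\<close>
lemma L_class_mult_sphere_measure:
  assumes "d \<ge> 1" "DIM('a::euclidean_space) = d + 1"
  shows "L_class 1 (real d) 2 * sphere_measure (sphere (0::'a) 1) = weyl_const d"
proof -
  define D where "D = real d"
  have D: "D > 0" using assms by (simp add: D_def)
  have notin: "x \<notin> \<int>\<^sub>\<le>\<^sub>0" if "x > 0" for x :: real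
    using that by (auto elim!: nonpos_Ints_cases)
  have G1: "Gamma (2 + D / 4) = (1 + D / 4) * Gamma (1 + D / 4)"
    using Gamma_plus1[OF notin, of "1 + D / 4"] D by (simp add: add_ac)
  have G2: "Gamma ((D + 1) / 2 + 1) = (D + 1) / 2 * Gamma ((D + 1) / 2)"
    using D by (intro Gamma_plus1 notin) simp
  have dup: "Gamma ((D + 1) / 2) * Gamma (1 + D / 2) = 2 powr (- D) * sqrt pi * Gamma (D + 1)"
  proof -
    have "(D + 1) / 2 + 1 / 2 = 1 + D / 2" "1 - 2 * ((D + 1) / 2) = - D" "2 * ((D + 1) / 2) = D + 1"
      by (simp_all add: field_simps)
    moreover have "(D + 1) / 2 > 0" using D by simp
    ultimately show ?thesis using Gamma_real_duplication[of "(D + 1) / 2"] by (simp only:)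
  qed
  have p4: "(4 * pi) powr (- (D / 2)) = 2 powr (- D) * pi powr (- (D / 2))"
    using powr_powr[of 2 2 "- (D / 2)"] by (simp add: powr_mult)
  have ppi: "pi powr (- (D / 2)) * pi powr ((D + 1) / 2) = sqrt pi"
  proof -
    have "- (D / 2) + (D + 1) / 2 = 1 / 2" by (simp add: field_simps)
    then have "pi powr (- (D / 2)) * pi powr ((D + 1) / 2) = pi powr (1 / 2)"
      by (simp only: flip: powr_add)
    then show ?thesis by (simp add: powr_half_sqrt)
  qed
  have pos: "Gamma ((D + 1) / 2) > 0" "Gamma (1 + D / 2) > 0" "Gamma (1 + D / 4) > 0"
    "Gamma (D + 1) > 0"
    using D by (auto intro!: Gamma_real_pos)
  have L: "L_class 1 D 2 = 2 powr (- D) * pi powr (- (D / 2)) * Gamma (1 + D / 4) /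
      (Gamma (1 + D / 2) * ((1 + D / 4) * Gamma (1 + D / 4)))"
    by (simp add: L_class_def p4 Gamma_numeral flip: G1)
  have V: "unit_ball_vol (D + 1) = pi powr ((D + 1) / 2) / ((D + 1) / 2 * Gamma ((D + 1) / 2))"
    unfolding unit_ball_vol_def G2 ..
  have cancel: "x * y * g\<^sub>4 / (g\<^sub>2 * ((1 + D / 4) * g\<^sub>4)) * ((D + 1) * (w / ((D + 1) / 2 * g\<^sub>1))) =
      x * (y * w) * 2 / ((1 + D / 4) * (g\<^sub>1 * g\<^sub>2))"
    if "g\<^sub>1 > 0" "g\<^sub>2 > 0" "g\<^sub>4 > 0" for x y w g\<^sub>1 g\<^sub>2 g\<^sub>4 :: real
  proof -
    have "(D + 1) * (w / ((D + 1) / 2 * g\<^sub>1)) = 2 * w / g\<^sub>1" using D that by simp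
    moreover have "x * y * g\<^sub>4 / (g\<^sub>2 * ((1 + D / 4) * g\<^sub>4)) = x * y / (g\<^sub>2 * (1 + D / 4))"
      using D that by simp
    ultimately show ?thesis by (simp add: mult_ac)
  qed
  have "L_class 1 D 2 * ((D + 1) * unit_ball_vol (D + 1)) =
      2 powr (- D) * (pi powr (- (D / 2)) * pi powr ((D + 1) / 2)) * 2 /
        ((1 + D / 4) * (Gamma ((D + 1) / 2) * Gamma (1 + D / 2)))"
    unfolding L V by (rule cancel) (use pos in auto)
  also have "\<dots> = 8 / ((D + 4) * Gamma (D + 1))"
  proof -
    have "x * r * 2 / ((1 + D / 4) * (x * r * g)) = 8 / ((D + 4) * g)"
      if "x > 0" "r > 0" "g > 0" for x r g :: real
      using that D by (simp add: divide_simps)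
    then show ?thesis unfolding dup ppi using pos(4) by simp
  qed
  also have "Gamma (D + 1) = fact d" by (simp add: D_def add.commute Gamma_fact)
  finally show ?thesis
    using assms(2) by (simp add: sphere_measure_unit_sphere weyl_const_def D_def add.commute)
qed

theorem theorem6p1p2:
  fixes d :: nat and lam :: "nat \<Rightarrow> real" and z :: real
  assumes "d \<ge> 3"
    and "DIM('a::euclidean_space) = d + 1"
    and "sphere_eigenvalue_sequence d lam"
    and "z \<ge> 0"
  shows "riesz_mean1 (\<lambda>j. (lam j)\<^sup>2) z
           \<ge> L_class 1 (real d) 2 * sphere_measure (sphere (0::'a) 1) * z powr (1 + real d / 4)
       \<and> L_class 1 (real d) 2 * sphere_measure (sphere (0::'a) 1) * z powr (1 + real d / 4)
           = 8 / ((real d + 4) * Gamma (real d + 1)) * z powr (1 + real d / 4)"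
proof -
  have "Gamma (real d + 1) = fact d" by (simp add: add.commute Gamma_fact)
  then show ?thesis
    using L_class_mult_sphere_measure[of d, where 'a = 'a] riesz_mean1_ge_weyl[OF assms(1,3,4)]
      assms(1,2)
    by (simp add: weyl_const_def)
qed

end
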